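(* Let $f,g,h$ be linearly independent holomorphic modular forms of weight $k$ on $\mathrm{SL}(2,\mathbb{Z})$ and let $\mathcal Ly=0$ be the differential equation $y'''+Q_2(z)y'+Q_3(z)y=0$ satisfied by $f/\sqrt[3]{W_{f,g,h}}$, $g/\sqrt[3]{W_{f,g,h}}$, and $h/\sqrt[3]{W_{f,g,h}}$. Then the local exponents of $\mathcal Ly=0$ at the elliptic points $\mathrm i$ and $\rho=(-1+\sqrt3\,\mathrm i)/2$ satisfy 1) $\kappa_{\mathrm i}^{(2)}-\kappa_{\mathrm i}^{(1)}\equiv\kappa_{\mathrm i}^{(3)}-\kappa_{\mathrm i}^{(1)}\equiv0\bmod 2$, and 2) $\kappa_\rho^{(j)}\in\mathbb{Z}$ for all $j$, and $\kappa_\rho^{(1)}\equiv\kappa_\rho^{(2)}\equiv\kappa_\rho^{(3)}\bmod 3$.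
   Context: $\mathrm i=\sqrt{-1}$, $'=\frac{d}{dz}$, $W_{f,g,h}=\det\begin{pmatrix} f&f'&f''\\ g&g'&g''\\ h&h'&h''\end{pmatrix}$ (the same branch of the cube root is used for all three functions). For $z_0$ in the upper half plane with $Q_j(z)=A_j(z-z_0)^{-j}+O((z-z_0)^{-j+1})$, $j=2,3$, the local exponents $\kappa_{z_0}^{(1)}\le\kappa_{z_0}^{(2)}\le\kappa_{z_0}^{(3)}$ at $z_0$ are the roots of $\kappa(\kappa-1)(\kappa-2)+A_2\kappa+A_3=0$. *)

theory Defs
  imports
    "HOL-Complex_Analysis.Complex_Analysis"
    "HOL-Library.Landau_Symbols"
    "HOL-Library.Real_Mod"
begin

definition upper_half_plane :: "complex set" where
  "upper_half_plane = {z. Im z > 0}"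

text \<open>
  Functions on the upper half plane are total functions on \<^typ>\<open>complex\<close> whose values outside
  of it are irrelevant.  Holomorphy at the cusp is expressed by the \<open>q\<close>-expansion with
  \<open>q = exp (2 \<pi> \<i> z)\<close>.
\<close>

definition modular_form :: "int \<Rightarrow> (complex \<Rightarrow> complex) \<Rightarrow> bool" where
  "modular_form k f \<longleftrightarrow>
     f holomorphic_on upper_half_plane \<and>
     (\<forall>a b c d :: int. a * d - b * c = 1 \<longrightarrow>
        (\<forall>z\<in>upper_half_plane.
           f ((of_int a * z + of_int b) / (of_int c * z + of_int d)) =
             (of_int c * z + of_int d) powi k * f z)) \<and>
     (\<exists>F. F holomorphic_on ball 0 1 \<and>
        (\<forall>z\<in>upper_half_plane. f z = F (exp (2 * of_real pi * \<i> * z))))"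

definition lin_indep3 ::
    "(complex \<Rightarrow> complex) \<Rightarrow> (complex \<Rightarrow> complex) \<Rightarrow> (complex \<Rightarrow> complex) \<Rightarrow> bool" where
  "lin_indep3 f g h \<longleftrightarrow>
     (\<forall>a b c :: complex. (\<forall>z\<in>upper_half_plane. a * f z + b * g z + c * h z = 0) \<longrightarrow>
        a = 0 \<and> b = 0 \<and> c = 0)"

definition wronskian3 ::
    "(complex \<Rightarrow> complex) \<Rightarrow> (complex \<Rightarrow> complex) \<Rightarrow> (complex \<Rightarrow> complex) \<Rightarrow> complex \<Rightarrow> complex" where
  "wronskian3 f g h z =
     det (vector [vector [f z, deriv f z, (deriv ^^ 2) f z],
                  vector [g z, deriv g z, (deriv ^^ 2) g z],
                  vector [h z, deriv h z, (deriv ^^ 2) h z]] :: complex^3^3)"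

definition solves_ode ::
    "(complex \<Rightarrow> complex) \<Rightarrow> (complex \<Rightarrow> complex) \<Rightarrow> complex set \<Rightarrow> (complex \<Rightarrow> complex) \<Rightarrow> bool" where
  "solves_ode Q2 Q3 U y \<longleftrightarrow>
     (\<forall>z\<in>U. (deriv ^^ 3) y z + Q2 z * deriv y z + Q3 z * y z = 0)"

text \<open>
  The quotients of \<open>f\<close>, \<open>g\<close>, \<open>h\<close> by the cube root of their Wronskian \<open>W\<close> are multivalued, with
  branch points at zeros of \<open>W\<close>.  They satisfy an equation if this holds for every holomorphic
  branch \<open>r\<close> of the cube root on an open set \<open>U\<close> without zeros of \<open>W\<close>.  Every point with \<open>W \<noteq> 0\<close>
  has a neighbourhood carrying such a branch.  For linearly independent \<open>f\<close>, \<open>g\<close>, \<open>h\<close> this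
  determines \<open>Q2\<close> and \<open>Q3\<close> off the (isolated) zeros of \<open>W\<close>.
\<close>

definition normalized_ode ::
    "(complex \<Rightarrow> complex) \<Rightarrow> (complex \<Rightarrow> complex) \<Rightarrow> (complex \<Rightarrow> complex) \<Rightarrow>
     (complex \<Rightarrow> complex) \<Rightarrow> (complex \<Rightarrow> complex) \<Rightarrow> bool" where
  "normalized_ode f g h Q2 Q3 \<longleftrightarrow>
     (\<forall>U r. open U \<and> U \<subseteq> upper_half_plane \<and> r holomorphic_on U \<and>
        (\<forall>z\<in>U. wronskian3 f g h z \<noteq> 0 \<and> r z ^ 3 = wronskian3 f g h z) \<longrightarrow>
        solves_ode Q2 Q3 U (\<lambda>z. f z / r z) \<and>
        solves_ode Q2 Q3 U (\<lambda>z. g z / r z) \<and>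
        solves_ode Q2 Q3 U (\<lambda>z. h z / r z))"

text \<open>
  \<open>A2\<close> and \<open>A3\<close>, and hence the sorted exponents with multiplicity, are uniquely determined by
  \<open>Q2\<close>, \<open>Q3\<close> and \<open>z0\<close>.  The ordering presupposes that the exponents are real.
\<close>

definition local_exponents ::
    "(complex \<Rightarrow> complex) \<Rightarrow> (complex \<Rightarrow> complex) \<Rightarrow> complex \<Rightarrow> real \<Rightarrow> real \<Rightarrow> real \<Rightarrow> bool" where
  "local_exponents Q2 Q3 z0 \<kappa>1 \<kappa>2 \<kappa>3 \<longleftrightarrow>
     \<kappa>1 \<le> \<kappa>2 \<and> \<kappa>2 \<le> \<kappa>3 \<and>
     (\<exists>A2 A3 :: complex.
        (\<lambda>z. Q2 z - A2 / (z - z0) ^ 2) \<in> O[at z0](\<lambda>z. 1 / (z - z0)) \<and>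
        (\<lambda>z. Q3 z - A3 / (z - z0) ^ 3) \<in> O[at z0](\<lambda>z. 1 / (z - z0) ^ 2) \<and>
        proots ([:0, 1:] * [:-1, 1:] * [:-2, 1:] + [:A3, A2:]) =
          {#of_real \<kappa>1, of_real \<kappa>2, of_real \<kappa>3#})"

end

theory Submission
  imports Defs
begin

text \<open>
  Let \<open>V\<close> be the span of \<open>f\<close>, \<open>g\<close>, \<open>h\<close> and let \<open>p\<close> be a point of the upper half plane.  Since
  \<open>dim V = 3\<close>, exactly three numbers \<open>a1 < a2 < a3\<close> occur as vanishing orders at \<open>p\<close> of nonzero
  elements of \<open>V\<close> (lemma \<open>span3_three_orders\<close> provides them).  If the Wronskian \<open>W\<close> vanishes to
  order \<open>N\<close> at \<open>p\<close>, an element \<open>u\<close> of order \<open>a\<close> gives a solution \<open>u / W^(1/3)\<close> that behaves like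
  \<open>(z - p)\<close> to the power \<open>a - N/3\<close>.  Hence the local exponents at \<open>p\<close> are \<open>aj - N/3\<close>.  The
  indicial polynomial has the form \<open>x^3 - 3 x^2 + ...\<close>, because the equation has no \<open>y''\<close> term, so
  the exponents add up to 3, that is, \<open>N = a1 + a2 + a3 - 3\<close> (lemma \<open>local_exponents_from_orders\<close>).

  Modularity enters through the stabiliser of \<open>p\<close>.  Let \<open>\<gamma>\<close> fix \<open>p\<close> and let
  \<open>j z = c z + d\<close> be its automorphy factor.  Comparing leading terms at \<open>p\<close> in
  \<open>u (\<gamma> z) = j z powi k * u z\<close> yields \<open>\<gamma>'(p)^a = j p powi k\<close> for the order \<open>a\<close> of every nonzero
  \<open>u \<in> V\<close>, where \<open>\<gamma>'(p) = 1 / (j p)^2\<close> (lemma \<open>zero_order_at_fixed_point\<close>).  The right side is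
  the same for all of \<open>V\<close>, so any two orders are congruent modulo the multiplicative order of
  \<open>\<gamma>'(p)\<close>.  This multiplier is \<open>-1\<close> at \<open>\<i>\<close>, for \<open>\<gamma> z = -1 / z\<close>, and a primitive cube root of unity
  at \<open>\<rho>\<close>, for \<open>\<gamma> z = -1 / (z + 1)\<close>.

  At \<open>\<i>\<close> the exponents therefore differ by even integers.  At \<open>\<rho>\<close> the three orders agree modulo 3,
  so their sum is divisible by 3 and with it \<open>N\<close>; thus the exponents \<open>aj - N/3\<close> are integers, and
  they agree modulo 3.
\<close>

section \<open>Vanishing orders in a three-dimensional space of functions\<close>

definition has_zero_order :: "(complex \<Rightarrow> complex) \<Rightarrow> complex \<Rightarrow> nat \<Rightarrow> bool" where
  "has_zero_order u p n \<longleftrightarrow>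
     (\<exists>v r. r > 0 \<and> v holomorphic_on ball p r \<and>
        (\<forall>z\<in>ball p r. v z \<noteq> 0 \<and> u z = (z - p) ^ n * v z))"

definition span3 ::
    "(complex \<Rightarrow> complex) \<Rightarrow> (complex \<Rightarrow> complex) \<Rightarrow> (complex \<Rightarrow> complex) \<Rightarrow> (complex \<Rightarrow> complex) set" where
  "span3 f g h = {u. \<exists>a b c. u = (\<lambda>z. a * f z + b * g z + c * h z)}"

lemma least_nonzero_deriv_is_order:
  assumes u: "u holomorphic_on S" and S: "open S" "p \<in> S"
    and n: "(deriv ^^ n) u p \<noteq> 0" and less: "\<And>i. i < n \<Longrightarrow> (deriv ^^ i) u p = 0"
  shows "has_zero_order u p n"
proof (cases "n = 0")
  case True
  then have "u p \<noteq> 0" using n by simp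
  have "open (S \<inter> u -` (- {0}))"
    by (rule continuous_open_preimage[OF holomorphic_on_imp_continuous_on[OF u] S(1)]) auto
  with \<open>u p \<noteq> 0\<close> S(2) obtain r where "r > 0" and r: "ball p r \<subseteq> S \<inter> u -` (- {0})"
    unfolding open_contains_ball by blast
  have "u holomorphic_on ball p r"
    by (rule holomorphic_on_subset[OF u]) (use r in auto)
  then show ?thesis
    unfolding has_zero_order_def using True r \<open>r > 0\<close>
    by (intro exI[of _ u] exI[of _ r]) auto
next
  case False
  then have n0: "0 < n" by simp
  obtain v r where vr: "0 < r" "v holomorphic_on ball p r"
      "\<And>w. w \<in> ball p r \<Longrightarrow> u w - u p = (w - p) ^ n * v w"
      "\<And>w. w \<in> ball p r \<Longrightarrow> v w \<noteq> 0"
    using holomorphic_factor_order_of_zero[OF u S n0 n] less by metis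
  have "u p = 0" using less[OF n0] by simp
  with vr(3,4) have "\<forall>z\<in>ball p r. v z \<noteq> 0 \<and> u z = (z - p) ^ n * v z" by simp
  with vr(1,2) show ?thesis unfolding has_zero_order_def by blast
qed

lemma holomorphic_has_zero_order:
  assumes u: "u holomorphic_on S" and S: "open S" "connected S" "p \<in> S"
    and nz: "w \<in> S" "u w \<noteq> 0"
  obtains n where "(deriv ^^ n) u p \<noteq> 0" "has_zero_order u p n"
proof -
  define n where "n = (LEAST n. (deriv ^^ n) u p \<noteq> 0)"
  have "\<exists>n. (deriv ^^ n) u p \<noteq> 0"
    using holomorphic_fun_eq_0_on_connected[OF u S(1,2) _ S(3) nz(1)] nz(2) by blast
  then have n: "(deriv ^^ n) u p \<noteq> 0" unfolding n_def by (rule LeastI_ex)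
  have "(deriv ^^ i) u p = 0" if "i < n" for i
    using not_less_Least[of i "\<lambda>n. (deriv ^^ n) u p \<noteq> 0"] that unfolding n_def by blast
  with n least_nonzero_deriv_is_order[OF u S(1,3)] that show thesis by blast
qed

lemma higher_deriv_linear_combination:
  fixes f g h :: "complex \<Rightarrow> complex"
  assumes "f holomorphic_on S" "g holomorphic_on S" "h holomorphic_on S" "open S" "z \<in> S"
  shows "(deriv ^^ n) (\<lambda>z. a * f z + b * g z + c * h z) z =
    a * (deriv ^^ n) f z + b * (deriv ^^ n) g z + c * (deriv ^^ n) h z"
proof -
  have "(deriv ^^ n) (\<lambda>z. a * f z + b * g z + c * h z) z =
     (deriv ^^ n) (\<lambda>z. a * f z + b * g z) z + (deriv ^^ n) (\<lambda>z. c * h z) z"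
    by (rule higher_deriv_add[of _ S]) (use assms in \<open>auto intro!: holomorphic_intros\<close>)
  also have "(deriv ^^ n) (\<lambda>z. a * f z + b * g z) z =
     (deriv ^^ n) (\<lambda>z. a * f z) z + (deriv ^^ n) (\<lambda>z. b * g z) z"
    by (rule higher_deriv_add[of _ S]) (use assms in \<open>auto intro!: holomorphic_intros\<close>)
  finally show ?thesis using assms by (simp add: higher_deriv_cmult[of _ S])
qed

text \<open>
  A matrix with a zero row is singular, so it annihilates a nonzero vector.
\<close>
lemma two_equations_three_unknowns:
  fixes x1 x2 x3 y1 y2 y3 :: complex
  obtains a b c where "a \<noteq> 0 \<or> b \<noteq> 0 \<or> c \<noteq> 0"
    "a * x1 + b * x2 + c * x3 = 0" "a * y1 + b * y2 + c * y3 = 0"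
proof -
  define A :: "complex^3^3" where "A = vector [vector [x1, x2, x3], vector [y1, y2, y3], 0]"
  have "det A = 0" unfolding A_def by (simp add: det_3)
  then have "\<not> (\<exists>B. B ** A = mat 1)"
    using invertible_det_nz[of A] invertible_left_inverse[of A] by simp
  then obtain t where t: "A *v t = 0" "t \<noteq> 0" unfolding matrix_left_invertible_ker by blast
  define a b c where "a = vec_nth t 1" and "b = vec_nth t 2" and "c = vec_nth t 3"
  have "a * x1 + b * x2 + c * x3 = vec_nth (A *v t) 1"
       "a * y1 + b * y2 + c * y3 = vec_nth (A *v t) 2"
    unfolding A_def matrix_vector_mult_def a_def b_def c_def by (simp_all add: sum_3 mult.commute)
  moreover have "a \<noteq> 0 \<or> b \<noteq> 0 \<or> c \<noteq> 0"
    using t(2) unfolding a_def b_def c_def by (auto simp: vec_eq_iff forall_3)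
  ultimately show thesis using t(1) that[of a b c] by simp
qed

lemma upper_half_plane_open_connected:
  "open upper_half_plane" "connected upper_half_plane"
proof -
  show "open upper_half_plane" unfolding upper_half_plane_def by (rule open_halfspace_Im_gt)
  show "connected upper_half_plane" unfolding upper_half_plane_def
    by (intro convex_connected convex_halfspace_Im_gt)
qed

text \<open>
  The vanishing of the derivatives of orders \<open>m1\<close> and \<open>m2\<close> at \<open>p\<close> imposes two linear conditions on
  the three coefficients of an element of the span.  A nonzero solution has a vanishing order, and
  this order is neither \<open>m1\<close> nor \<open>m2\<close> because the derivative of that order does not vanish.
\<close>
lemma span3_avoids_two_orders:
  assumes hol: "f holomorphic_on upper_half_plane" "g holomorphic_on upper_half_plane"
      "h holomorphic_on upper_half_plane"
    and indep: "lin_indep3 f g h" and p: "p \<in> upper_half_plane"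
  obtains u n where "u \<in> span3 f g h" "has_zero_order u p n" "n \<noteq> m1" "n \<noteq> m2"
proof -
  obtain a b c where nz: "a \<noteq> 0 \<or> b \<noteq> 0 \<or> c \<noteq> 0"
    and eq: "a * (deriv ^^ m1) f p + b * (deriv ^^ m1) g p + c * (deriv ^^ m1) h p = 0"
      "a * (deriv ^^ m2) f p + b * (deriv ^^ m2) g p + c * (deriv ^^ m2) h p = 0"
    by (rule two_equations_three_unknowns)
  define u where "u = (\<lambda>z. a * f z + b * g z + c * h z)"
  have "u holomorphic_on upper_half_plane"
    unfolding u_def by (intro holomorphic_intros hol)
  moreover obtain w where "w \<in> upper_half_plane" "u w \<noteq> 0"
    using indep nz unfolding lin_indep3_def u_def by blast
  ultimately obtain n where n: "(deriv ^^ n) u p \<noteq> 0" "has_zero_order u p n"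
    using holomorphic_has_zero_order[OF _ upper_half_plane_open_connected p] by blast
  have "(deriv ^^ m) u p = a * (deriv ^^ m) f p + b * (deriv ^^ m) g p + c * (deriv ^^ m) h p" for m
    unfolding u_def
    by (rule higher_deriv_linear_combination[OF hol upper_half_plane_open_connected(1) p])
  then have "(deriv ^^ m1) u p = 0" "(deriv ^^ m2) u p = 0" using eq by simp_all
  with n have "n \<noteq> m1" "n \<noteq> m2" by auto
  moreover have "u \<in> span3 f g h" unfolding span3_def u_def by blast
  ultimately show thesis using n(2) that by blast
qed

text \<open>
  Avoiding the orders found so far produces three distinct ones, which are then sorted.
\<close>
lemma span3_three_orders:
  assumes hol: "f holomorphic_on upper_half_plane" "g holomorphic_on upper_half_plane"
      "h holomorphic_on upper_half_plane"
    and indep: "lin_indep3 f g h" and p: "p \<in> upper_half_plane"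
  obtains u1 u2 u3 a1 a2 a3 where "u1 \<in> span3 f g h" "u2 \<in> span3 f g h" "u3 \<in> span3 f g h"
    "has_zero_order u1 p a1" "has_zero_order u2 p a2" "has_zero_order u3 p a3"
    "a1 < a2" "a2 < a3"
proof -
  let ?P = "\<lambda>n. \<exists>u\<in>span3 f g h. has_zero_order u p n"
  have *: "\<exists>n. ?P n \<and> n \<noteq> m1 \<and> n \<noteq> m2" for m1 m2
    by (rule span3_avoids_two_orders[OF assms, of m1 m2]) blast
  obtain x where x: "?P x" using * by blast
  obtain y where y: "?P y" "y \<noteq> x" using * by blast
  obtain w where w: "?P w" "w \<noteq> x" "w \<noteq> y" using * by blast
  have "\<exists>a b c. ?P a \<and> ?P b \<and> ?P c \<and> a < b \<and> b < c"
  proof -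
    consider "x < y" "y < w" | "x < w" "w < y" | "y < x" "x < w" | "y < w" "w < x"
      | "w < x" "x < y" | "w < y" "y < x" using y(2) w(2,3) by linarith
    then show ?thesis using x y(1) w(1) by cases blast+
  qed
  then show thesis using that by blast
qed

section \<open>Derivatives of functions with an exponent at a point\<close>

text \<open>
  If \<open>y = (z - p)^a * v * E\<close> with \<open>E' = - \<sigma> / (z - p) * E\<close>, then every derivative of \<open>y\<close> again has
  this shape, the exponent of \<open>z - p\<close> dropping by one each time.  The function \<open>reduced_deriv\<close> is
  the remaining factor, which replaces \<open>v\<close>; it stays holomorphic at \<open>p\<close>.  For
  \<open>E = W^(-1/3)\<close> the function \<open>\<sigma>\<close> is \<open>(z - p) W' / (3 W)\<close>, for \<open>E = 1\<close> it is \<open>0\<close>.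
\<close>
primrec reduced_deriv ::
    "complex \<Rightarrow> (complex \<Rightarrow> complex) \<Rightarrow> nat \<Rightarrow> (complex \<Rightarrow> complex) \<Rightarrow> nat \<Rightarrow> complex \<Rightarrow> complex" where
  "reduced_deriv p \<sigma> a v 0 = v"
| "reduced_deriv p \<sigma> a v (Suc m) = (\<lambda>z.
     (of_nat a - of_nat m - \<sigma> z) * reduced_deriv p \<sigma> a v m z +
     (z - p) * deriv (reduced_deriv p \<sigma> a v m) z)"

lemma reduced_deriv_holomorphic:
  assumes "v holomorphic_on S" "\<sigma> holomorphic_on S" "open S"
  shows "reduced_deriv p \<sigma> a v m holomorphic_on S"
  by (induction m) (use assms in \<open>auto intro!: holomorphic_intros\<close>)

text \<open>
  With \<open>\<kappa> = a - \<sigma> p\<close> the product is the falling factorial \<open>\<kappa> (\<kappa> - 1) ... (\<kappa> - m + 1)\<close>, as for the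
  derivatives of the pure power \<open>(z - p)^\<kappa>\<close>.  This is what produces the indicial polynomial.
\<close>
lemma reduced_deriv_center:
  "reduced_deriv p \<sigma> a v m p = (\<Prod>i<m. of_nat a - \<sigma> p - of_nat i) * v p"
  by (induction m) (auto simp: algebra_simps)

lemma higher_deriv_eq_reduced_deriv:
  assumes v: "v holomorphic_on S" and \<sigma>: "\<sigma> holomorphic_on S" and S: "open S"
    and U: "open U" "U \<subseteq> S - {p}"
    and E: "\<And>z. z \<in> U \<Longrightarrow> (E has_field_derivative - (\<sigma> z / (z - p)) * E z) (at z)"
    and y: "\<And>z. z \<in> U \<Longrightarrow> y z = (z - p) ^ a * v z * E z"
    and z: "z \<in> U"
  shows "(deriv ^^ m) y z = (z - p) powi (int a - int m) * reduced_deriv p \<sigma> a v m z * E z"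
  using z
proof (induction m arbitrary: z)
  case 0
  then show ?case using y by simp
next
  case (Suc m)
  let ?R = "reduced_deriv p \<sigma> a v m" and ?e = "int a - int m"
  have zp: "z - p \<noteq> 0" and zS: "z \<in> S" using Suc.prems U by auto
  have dR: "(?R has_field_derivative deriv ?R z) (at z)"
    using reduced_deriv_holomorphic[OF v \<sigma> S] S zS by (rule holomorphic_derivI)
  have "((deriv ^^ m) y has_field_derivative
      (of_int ?e * (z - p) powi (?e - 1) * 1) * (?R z * E z) +
      (deriv ?R z * E z + (- (\<sigma> z / (z - p)) * E z) * ?R z) * (z - p) powi ?e) (at z)"
  proof (rule has_field_derivative_transform_within_open[OF _ U(1) Suc.prems])
    show "((\<lambda>z. (z - p) powi ?e * (?R z * E z)) has_field_derivative
      (of_int ?e * (z - p) powi (?e - 1) * 1) * (?R z * E z) +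
      (deriv ?R z * E z + (- (\<sigma> z / (z - p)) * E z) * ?R z) * (z - p) powi ?e) (at z)"
      by (intro DERIV_mult DERIV_power_int dR E Suc.prems)
        (use zp in \<open>auto intro!: derivative_eq_intros\<close>)
  qed (use Suc.IH in \<open>simp add: mult.assoc\<close>)
  then have "(deriv ^^ Suc m) y z = (of_int ?e * (z - p) powi (?e - 1) * 1) * (?R z * E z) +
      (deriv ?R z * E z + (- (\<sigma> z / (z - p)) * E z) * ?R z) * (z - p) powi ?e"
    by (simp add: DERIV_imp_deriv)
  also have "(z - p) powi ?e = (z - p) powi (?e - 1) * (z - p)"
    using zp power_int_add_1[of "z - p" "?e - 1"] by simp
  also have "(of_int ?e * (z - p) powi (?e - 1) * 1) * (?R z * E z) +
      (deriv ?R z * E z + (- (\<sigma> z / (z - p)) * E z) * ?R z) * ((z - p) powi (?e - 1) * (z - p)) =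
      (z - p) powi (?e - 1) * reduced_deriv p \<sigma> a v (Suc m) z * E z"
    using zp by (simp add: field_simps)
  finally show ?case by (simp add: algebra_simps)
qed

section \<open>The Wronskian\<close>

text \<open>
  The factorisation restricts to every smaller ball, so those of several functions can be
  used on a common one.
\<close>
lemma has_zero_orderE:
  assumes "has_zero_order u p n"
  obtains v R where "R > 0" "\<And>r. r \<le> R \<Longrightarrow> v holomorphic_on ball p r"
    "\<And>z. dist p z < R \<Longrightarrow> v z \<noteq> 0" "\<And>z. dist p z < R \<Longrightarrow> u z = (z - p) ^ n * v z"
proof -
  obtain v R where "R > 0" and v: "v holomorphic_on ball p R"
      and eq: "\<forall>z\<in>ball p R. v z \<noteq> 0 \<and> u z = (z - p) ^ n * v z"
    using assms unfolding has_zero_order_def by blast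
  show thesis
  proof (rule that[of R v])
    show "v holomorphic_on ball p r" if "r \<le> R" for r
      by (rule holomorphic_on_subset[OF v]) (use that in auto)
  qed (use \<open>R > 0\<close> eq in auto)
qed

lemma wronskian3_expand:
  "wronskian3 f g h z =
     f z * (deriv g z * (deriv ^^ 2) h z - (deriv ^^ 2) g z * deriv h z) -
     g z * (deriv f z * (deriv ^^ 2) h z - (deriv ^^ 2) f z * deriv h z) +
     h z * (deriv f z * (deriv ^^ 2) g z - (deriv ^^ 2) f z * deriv g z)"
  unfolding wronskian3_def det_3 vector_3 by (simp add: algebra_simps)

text \<open>
  Up to a power of \<open>z - p\<close> the Wronskian is a determinant of reduced derivatives.  Its rows at \<open>p\<close>
  are multiples of \<open>(1, a, a (a - 1))\<close>, so its value there is a nonzero multiple of the Vandermonde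
  determinant of the orders.
\<close>
lemma wronskian3_nonzero_of_distinct_orders:
  assumes "has_zero_order u1 p a1" "has_zero_order u2 p a2" "has_zero_order u3 p a3"
    and distinct: "a1 \<noteq> a2" "a1 \<noteq> a3" "a2 \<noteq> a3"
  shows "\<forall>\<^sub>F z in at p. wronskian3 u1 u2 u3 z \<noteq> 0"
proof -
  obtain v1 R1 where v1: "R1 > 0" "\<And>r. r \<le> R1 \<Longrightarrow> v1 holomorphic_on ball p r"
    "\<And>z. dist p z < R1 \<Longrightarrow> v1 z \<noteq> 0" "\<And>z. dist p z < R1 \<Longrightarrow> u1 z = (z - p) ^ a1 * v1 z"
    using has_zero_orderE[OF assms(1)] by metis
  obtain v2 R2 where v2: "R2 > 0" "\<And>r. r \<le> R2 \<Longrightarrow> v2 holomorphic_on ball p r"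
    "\<And>z. dist p z < R2 \<Longrightarrow> v2 z \<noteq> 0" "\<And>z. dist p z < R2 \<Longrightarrow> u2 z = (z - p) ^ a2 * v2 z"
    using has_zero_orderE[OF assms(2)] by metis
  obtain v3 R3 where v3: "R3 > 0" "\<And>r. r \<le> R3 \<Longrightarrow> v3 holomorphic_on ball p r"
    "\<And>z. dist p z < R3 \<Longrightarrow> v3 z \<noteq> 0" "\<And>z. dist p z < R3 \<Longrightarrow> u3 z = (z - p) ^ a3 * v3 z"
    using has_zero_orderE[OF assms(3)] by metis
  define r where "r = Min {R1, R2, R3}"
  have r: "r > 0" "r \<le> R1" "r \<le> R2" "r \<le> R3" unfolding r_def using v1(1) v2(1) v3(1) by auto
  let ?B = "ball p r"
  let ?r = "reduced_deriv p (\<lambda>_. 0)"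
  have op: "open (?B - {p})" by (intro open_delete open_ball)
  have hol: "?r a1 v1 m holomorphic_on ?B" "?r a2 v2 m holomorphic_on ?B"
      "?r a3 v3 m holomorphic_on ?B" for m
    using v1(2) v2(2) v3(2) r by (auto intro!: reduced_deriv_holomorphic)
  define D where "D = (\<lambda>z.
     ?r a1 v1 0 z * (?r a2 v2 1 z * ?r a3 v3 2 z - ?r a2 v2 2 z * ?r a3 v3 1 z) -
     ?r a2 v2 0 z * (?r a1 v1 1 z * ?r a3 v3 2 z - ?r a1 v1 2 z * ?r a3 v3 1 z) +
     ?r a3 v3 0 z * (?r a1 v1 1 z * ?r a2 v2 2 z - ?r a1 v1 2 z * ?r a2 v2 1 z))"
  have "D holomorphic_on ?B" unfolding D_def by (intro holomorphic_intros hol)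
  then have "isCont D p"
    using r holomorphic_on_imp_continuous_on[of D ?B] by (simp add: continuous_on_eq_continuous_at)
  moreover have "D p \<noteq> 0"
  proof -
    let ?a = "of_nat a1 :: complex" and ?b = "of_nat a2 :: complex" and ?c = "of_nat a3 :: complex"
    have 0: "?r a v 0 p = v p" "?r a v 1 p = of_nat a * v p"
        "?r a v 2 p = of_nat a * (of_nat a - 1) * v p" for a v
      unfolding reduced_deriv_center by (simp_all add: numeral_2_eq_2)
    have "D p = (?b - ?a) * (?c - ?a) * (?c - ?b) * (v1 p * v2 p * v3 p)"
      unfolding D_def 0 by (simp add: algebra_simps)
    then show ?thesis using v1(1,3) v2(1,3) v3(1,3) distinct by simp
  qed
  ultimately have "\<forall>\<^sub>F z in at p. D z \<noteq> 0"
    by (intro tendsto_imp_eventually_ne[of D "D p"]) (auto simp: isCont_def)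
  moreover have "\<forall>\<^sub>F z in at p. z \<in> ?B - {p}"
    using r by (intro eventually_at_in_open) auto
  ultimately show ?thesis
  proof eventually_elim
    case (elim z)
    define d where "d = z - p"
    have d: "d \<noteq> 0" using elim unfolding d_def by simp
    let ?P = "\<lambda>a. d ^ a"
    have eq: "(deriv ^^ m) u z = ?P a / d ^ m * ?r a v m z"
      if "v holomorphic_on ?B" "\<And>z. dist p z < r \<Longrightarrow> u z = (z - p) ^ a * v z" for u v a m
      using higher_deriv_eq_reduced_deriv[of v ?B "\<lambda>_. 0" "?B - {p}" p "\<lambda>_. 1" u a z m] that elim d op
      unfolding d_def by (simp add: power_int_diff)
    have eq1: "(deriv ^^ m) u1 z = ?P a1 / d ^ m * ?r a1 v1 m z" for m
      by (rule eq) (use v1(2)[of r] v1(4) r in auto)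
    have eq2: "(deriv ^^ m) u2 z = ?P a2 / d ^ m * ?r a2 v2 m z" for m
      by (rule eq) (use v2(2)[of r] v2(4) r in auto)
    have eq3: "(deriv ^^ m) u3 z = ?P a3 / d ^ m * ?r a3 v3 m z" for m
      by (rule eq) (use v3(2)[of r] v3(4) r in auto)
    have W: "wronskian3 u1 u2 u3 z =
       (deriv ^^ 0) u1 z * ((deriv ^^ 1) u2 z * (deriv ^^ 2) u3 z - (deriv ^^ 2) u2 z * (deriv ^^ 1) u3 z) -
       (deriv ^^ 0) u2 z * ((deriv ^^ 1) u1 z * (deriv ^^ 2) u3 z - (deriv ^^ 2) u1 z * (deriv ^^ 1) u3 z) +
       (deriv ^^ 0) u3 z * ((deriv ^^ 1) u1 z * (deriv ^^ 2) u2 z - (deriv ^^ 2) u1 z * (deriv ^^ 1) u2 z)"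
      unfolding wronskian3_expand by simp
    have "wronskian3 u1 u2 u3 z = ?P a1 * ?P a2 * ?P a3 / d ^ 3 * D z"
      unfolding W D_def eq1 eq2 eq3
      using d by (simp add: field_simps power2_eq_square power3_eq_cube del: reduced_deriv.simps)
    then show ?case using elim d by simp
  qed
qed

lemma wronskian3_holomorphic:
  assumes "f holomorphic_on S" "g holomorphic_on S" "h holomorphic_on S" "open S"
  shows "wronskian3 f g h holomorphic_on S"
  unfolding wronskian3_expand
  by (intro holomorphic_intros holomorphic_higher_deriv assms)

text \<open>
  Passing to linear combinations multiplies the Wronskian by the determinant of the matrix of
  coefficients.
\<close>
lemma wronskian3_span3:
  assumes hol: "f holomorphic_on S" "g holomorphic_on S" "h holomorphic_on S" "open S" "z \<in> S"
    and u: "u1 \<in> span3 f g h" "u2 \<in> span3 f g h" "u3 \<in> span3 f g h"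
    and nz: "wronskian3 u1 u2 u3 z \<noteq> 0"
  shows "wronskian3 f g h z \<noteq> 0"
proof -
  let ?row = "\<lambda>u. vector [u z, deriv u z, (deriv ^^ 2) u z] :: complex^3"
  let ?F = "vector [?row f, ?row g, ?row h] :: complex^3^3"
  have lin: "\<exists>c :: complex^3. ?row u = c v* ?F" if u: "u \<in> span3 f g h" for u
  proof -
    obtain a b c where ueq: "u = (\<lambda>z. a * f z + b * g z + c * h z)" using u unfolding span3_def by blast
    have "(deriv ^^ n) u z = a * (deriv ^^ n) f z + b * (deriv ^^ n) g z + c * (deriv ^^ n) h z" for n
      unfolding ueq by (rule higher_deriv_linear_combination[OF hol])
    from this[of 0] this[of 1] this[of 2] have "?row u = vector [a, b, c] v* ?F"
      by (simp add: vec_eq_iff forall_3 vector_matrix_mult_def sum_3 mult.commute)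
    then show ?thesis by blast
  qed
  obtain c1 c2 c3 where c: "?row u1 = c1 v* ?F" "?row u2 = c2 v* ?F" "?row u3 = c3 v* ?F"
    using lin[OF u(1)] lin[OF u(2)] lin[OF u(3)] by blast
  have "vector [?row u1, ?row u2, ?row u3] = (vector [c1, c2, c3] :: complex^3^3) ** ?F"
    unfolding c by (simp add: vec_eq_iff forall_3 vector_matrix_mult_def matrix_matrix_mult_def sum_3 mult.commute)
  then have "wronskian3 u1 u2 u3 z = det (vector [c1, c2, c3] :: complex^3^3) * wronskian3 f g h z"
    unfolding wronskian3_def by (simp add: det_mul)
  then show ?thesis using nz by simp
qed

section \<open>The differential equation near a point\<close>

lemma solves_ode_span3:
  assumes ode: "normalized_ode f g h Q2 Q3"
    and hol: "f holomorphic_on upper_half_plane" "g holomorphic_on upper_half_plane"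
      "h holomorphic_on upper_half_plane"
    and U: "open U" "U \<subseteq> upper_half_plane" and s: "s holomorphic_on U"
    and cube: "\<And>z. z \<in> U \<Longrightarrow> wronskian3 f g h z \<noteq> 0 \<and> s z ^ 3 = wronskian3 f g h z"
    and u: "u \<in> span3 f g h"
  shows "solves_ode Q2 Q3 U (\<lambda>z. u z / s z)"
proof -
  have ode_fgh: "solves_ode Q2 Q3 U (\<lambda>z. f z / s z)" "solves_ode Q2 Q3 U (\<lambda>z. g z / s z)"
      "solves_ode Q2 Q3 U (\<lambda>z. h z / s z)"
    using ode U s cube unfolding normalized_ode_def by blast+
  have s0: "s z \<noteq> 0" if "z \<in> U" for z using cube[OF that] by auto
  have hol': "(\<lambda>z. f z / s z) holomorphic_on U" "(\<lambda>z. g z / s z) holomorphic_on U"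
      "(\<lambda>z. h z / s z) holomorphic_on U"
    by (intro holomorphic_intros s hol[THEN holomorphic_on_subset] U(2) s0; assumption)+
  obtain a b c where ueq: "u = (\<lambda>z. a * f z + b * g z + c * h z)"
    using u unfolding span3_def by blast
  have quot: "(\<lambda>z. u z / s z) = (\<lambda>z. a * (f z / s z) + b * (g z / s z) + c * (h z / s z))"
    unfolding ueq by (simp add: add_divide_distrib)
  have lin: "(deriv ^^ n) (\<lambda>z. u z / s z) z = a * (deriv ^^ n) (\<lambda>z. f z / s z) z +
      b * (deriv ^^ n) (\<lambda>z. g z / s z) z + c * (deriv ^^ n) (\<lambda>z. h z / s z) z"
    if "z \<in> U" for n z
    unfolding quot using that by (rule higher_deriv_linear_combination[OF hol' U(1)])
  show ?thesis unfolding solves_ode_def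
  proof
    fix z assume z: "z \<in> U"
    have "(deriv ^^ 3) (\<lambda>z. u z / s z) z + Q2 z * deriv (\<lambda>z. u z / s z) z + Q3 z * (u z / s z) =
       a * ((deriv ^^ 3) (\<lambda>z. f z / s z) z + Q2 z * deriv (\<lambda>z. f z / s z) z + Q3 z * (f z / s z)) +
       b * ((deriv ^^ 3) (\<lambda>z. g z / s z) z + Q2 z * deriv (\<lambda>z. g z / s z) z + Q3 z * (g z / s z)) +
       c * ((deriv ^^ 3) (\<lambda>z. h z / s z) z + Q2 z * deriv (\<lambda>z. h z / s z) z + Q3 z * (h z / s z))"
      using lin[OF z, of 3] lin[OF z, of 1] lin[OF z, of 0] by (simp add: algebra_simps)
    also have "\<dots> = 0" using ode_fgh z unfolding solves_ode_def by simp
    finally show "(deriv ^^ 3) (\<lambda>z. u z / s z) z + Q2 z * deriv (\<lambda>z. u z / s z) z +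
        Q3 z * (u z / s z) = 0" .
  qed
qed

text \<open>
  On a small disc off \<open>p\<close> there is a logarithm \<open>L\<close> of \<open>W\<close>, and \<open>exp (L / 3)\<close> is a branch of the cube
  root.  Its logarithmic derivative \<open>W' / (3 W) = \<sigma> / (z - p)\<close> does not depend on the branch, and
  \<open>\<sigma>\<close> extends holomorphically to \<open>p\<close>.  The multivalued root is thus replaced by a function on the
  whole ball.
\<close>
lemma inverse_cube_root_branch:
  assumes w: "w holomorphic_on ball p r" "\<And>z. z \<in> ball p r \<Longrightarrow> w z \<noteq> 0"
    and W: "\<And>z. z \<in> ball p r \<Longrightarrow> W z = (z - p) ^ N * w z"
    and z: "z \<in> ball p r - {p}"
    and \<sigma>: "\<sigma> = (\<lambda>z. (of_nat N + (z - p) * deriv w z / w z) / 3)"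
  obtains U s where "open U" "z \<in> U" "U \<subseteq> ball p r - {p}" "s holomorphic_on U"
    "\<And>t. t \<in> U \<Longrightarrow> W t \<noteq> 0 \<and> s t ^ 3 = W t"
    "\<And>t. t \<in> U \<Longrightarrow> ((\<lambda>z. 1 / s z) has_field_derivative - (\<sigma> t / (t - p)) * (1 / s t)) (at t)"
proof -
  have op: "open (ball p r - {p})" by (intro open_delete open_ball)
  obtain e where "e > 0" and e: "ball z e \<subseteq> ball p r - {p}"
    using z op open_contains_ball by blast
  define U where "U = ball z e"
  have U: "open U" "z \<in> U" "U \<subseteq> ball p r - {p}" "convex U" unfolding U_def using \<open>e > 0\<close> e by auto
  have dw: "(w has_field_derivative deriv w t) (at t)" if "t \<in> U" for t
    using w(1) open_ball that U(3) by (auto intro: holomorphic_derivI)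
  have W_deriv: "(W has_field_derivative 3 * \<sigma> t / (t - p) * W t) (at t)" if t: "t \<in> U" for t
  proof (rule has_field_derivative_transform_within_open[OF _ U(1) t])
    have tp: "t - p \<noteq> 0" and tr: "t \<in> ball p r" using t U(3) by auto
    show "((\<lambda>t. (t - p) ^ N * w t) has_field_derivative 3 * \<sigma> t / (t - p) * W t) (at t)"
    proof (rule DERIV_cong)
      show "((\<lambda>t. (t - p) ^ N * w t) has_field_derivative
          of_nat N * (t - p) ^ (N - 1) * w t + (t - p) ^ N * deriv w t) (at t)"
        by (auto intro!: derivative_eq_intros dw t)
      have "of_nat N * (t - p) ^ (N - 1) = of_nat N * (t - p) ^ N / (t - p)"
        using tp by (cases N) auto
      then show "of_nat N * (t - p) ^ (N - 1) * w t + (t - p) ^ N * deriv w t =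
          3 * \<sigma> t / (t - p) * W t"
        using tp w(2)[OF tr] unfolding \<sigma> W[OF tr]
        by (simp add: add_divide_distrib distrib_right distrib_left)
    qed
  qed (use W U(3) in auto)
  have W_hol: "W holomorphic_on U"
    using W_deriv U(1) holomorphic_on_open by blast
  have W0: "W t \<noteq> 0" if "t \<in> U" for t
    using that U(3) W w(2) by auto
  obtain L where L: "L holomorphic_on U" and exp_L: "\<And>t. t \<in> U \<Longrightarrow> exp (L t) = W t"
    using holomorphic_logarithm_exists[OF U(4,1) W_hol W0 U(2)] by blast
  have L_deriv: "(L has_field_derivative 3 * \<sigma> t / (t - p)) (at t)" if t: "t \<in> U" for t
  proof -
    have dL: "(L has_field_derivative deriv L t) (at t)" using L U(1) t by (rule holomorphic_derivI)
    have "((\<lambda>t. exp (L t)) has_field_derivative exp (L t) * deriv L t) (at t)"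
      by (rule DERIV_fun_exp[OF dL])
    then have "(W has_field_derivative exp (L t) * deriv L t) (at t)"
      by (rule has_field_derivative_transform_within_open[OF _ U(1) t]) (rule exp_L)
    then have "exp (L t) * deriv L t = 3 * \<sigma> t / (t - p) * W t"
      using W_deriv[OF t] by (rule DERIV_unique)
    then have "W t * deriv L t = W t * (3 * \<sigma> t / (t - p))"
      unfolding exp_L[OF t] by (simp add: mult.commute)
    then have "deriv L t = 3 * \<sigma> t / (t - p)" unfolding mult_left_cancel[OF W0[OF t]] .
    with dL show ?thesis by simp
  qed
  define s where "s = (\<lambda>t. exp (L t / 3))"
  show thesis
  proof (rule that[of U s])
    show "s holomorphic_on U" unfolding s_def by (intro holomorphic_intros L) auto
    fix t assume t: "t \<in> U"
    have "s t ^ 3 = W t" unfolding s_def using exp_L[OF t] by (simp flip: exp_of_nat_mult)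
    then show "W t \<noteq> 0 \<and> s t ^ 3 = W t" using W0[OF t] by simp
    have "t - p \<noteq> 0" using t U(3) by auto
    then show "((\<lambda>z. 1 / s z) has_field_derivative - (\<sigma> t / (t - p)) * (1 / s t)) (at t)"
      unfolding s_def by (auto intro!: derivative_eq_intros L_deriv t simp: field_simps)
  qed (use U in auto)
qed

text \<open>
  Substituting \<open>y = (z - p)^a * v * W^(-1/3)\<close> into the equation and dividing by
  \<open>(z - p)^(a - 3) * W^(-1/3)\<close> leaves a relation between functions on the whole punctured ball.
\<close>
lemma reduced_ode:
  assumes ode: "normalized_ode f g h Q2 Q3"
    and hol: "f holomorphic_on upper_half_plane" "g holomorphic_on upper_half_plane"
      "h holomorphic_on upper_half_plane"
    and r: "ball p r \<subseteq> upper_half_plane"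
    and w: "w holomorphic_on ball p r" "\<And>z. z \<in> ball p r \<Longrightarrow> w z \<noteq> 0"
    and W: "\<And>z. z \<in> ball p r \<Longrightarrow> wronskian3 f g h z = (z - p) ^ N * w z"
    and \<sigma>: "\<sigma> = (\<lambda>z. (of_nat N + (z - p) * deriv w z / w z) / 3)"
    and u: "u \<in> span3 f g h"
    and v: "v holomorphic_on ball p r" "\<And>z. z \<in> ball p r \<Longrightarrow> u z = (z - p) ^ a * v z"
    and z: "z \<in> ball p r - {p}"
  shows "reduced_deriv p \<sigma> a v 3 z + (z - p) ^ 2 * Q2 z * reduced_deriv p \<sigma> a v 1 z +
     (z - p) ^ 3 * Q3 z * v z = 0"
proof -
  obtain U s where U: "open U" "z \<in> U" "U \<subseteq> ball p r - {p}" and s: "s holomorphic_on U"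
    and s3: "\<And>t. t \<in> U \<Longrightarrow> wronskian3 f g h t \<noteq> 0 \<and> s t ^ 3 = wronskian3 f g h t"
    and ds: "\<And>t. t \<in> U \<Longrightarrow> ((\<lambda>z. 1 / s z) has_field_derivative - (\<sigma> t / (t - p)) * (1 / s t)) (at t)"
    using inverse_cube_root_branch[where W = "wronskian3 f g h", OF w W z \<sigma>] by blast
  let ?y = "\<lambda>z. u z / s z" and ?R = "reduced_deriv p \<sigma> a v"
  define d where "d = z - p"
  have d: "d \<noteq> 0" unfolding d_def using z by auto
  have "solves_ode Q2 Q3 U ?y"
    by (rule solves_ode_span3[OF ode hol U(1) _ s s3 u]) (use U(3) r in auto)
  then have eq: "(deriv ^^ 3) ?y z + Q2 z * (deriv ^^ 1) ?y z + Q3 z * (deriv ^^ 0) ?y z = 0"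
    using U(2) unfolding solves_ode_def by simp
  have "\<sigma> holomorphic_on ball p r"
    unfolding \<sigma> by (intro holomorphic_intros w) auto
  then have "(deriv ^^ m) ?y z = (z - p) powi (int a - int m) * ?R m z * (1 / s z)" for m
    by (rule higher_deriv_eq_reduced_deriv[OF v(1) _ open_ball U(1,3) ds _ U(2)])
      (use v(2) U(3) in auto)
  then have y: "(deriv ^^ m) ?y z = d ^ a / d ^ m * ?R m z / s z" for m
    using d unfolding d_def by (simp add: power_int_diff)
  have s0: "s z \<noteq> 0" using s3[OF U(2)] by auto
  have "d ^ a / s z / d ^ 3 * (?R 3 z + d ^ 2 * Q2 z * ?R 1 z + d ^ 3 * Q3 z * v z) =
      d ^ a / d ^ 3 * ?R 3 z / s z + Q2 z * (d ^ a / d ^ 1 * ?R 1 z / s z) +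
      Q3 z * (d ^ a / d ^ 0 * ?R 0 z / s z)"
    using d s0
    by (simp add: field_simps power2_eq_square power3_eq_cube del: reduced_deriv.simps(2))
  also have "\<dots> = 0" using eq unfolding y .
  finally show ?thesis using d s0 unfolding d_def by simp
qed

section \<open>The indicial equation\<close>

lemma field_differentiable_diff_bigo:
  assumes "G field_differentiable at p"
  shows "(\<lambda>z. G z - G p) \<in> O[at p](\<lambda>z. z - p)"
proof -
  obtain D where "(G has_field_derivative D) (at p)"
    using assms unfolding field_differentiable_def by blast
  then have "((\<lambda>z. (G z - G p) / (z - p)) \<longlongrightarrow> D) (at p)"
    by (simp add: has_field_derivative_iff)
  moreover have "\<forall>\<^sub>F z in at p. z - p \<noteq> 0" by (simp add: eventually_at_filter)
  ultimately show ?thesis by (rule bigoI_tendsto)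
qed

text \<open>
  Two of the relations determine \<open>q2\<close> and \<open>q3\<close> near \<open>p\<close> by Cramer's rule.  The denominator
  \<open>x 0 - x 1\<close> does not vanish at \<open>p\<close>, so the solutions \<open>G2\<close> and \<open>G3\<close> are differentiable there,
  and each relation persists at \<open>p\<close> by continuity.  Applied to
  \<open>q2 = (z - p)^2 * Q2\<close> and \<open>q3 = (z - p)^3 * Q3\<close>, this yields the leading coefficients of
  \<open>Q2\<close> and \<open>Q3\<close> at the regular singular point \<open>p\<close> together with the indicial equation.
\<close>
lemma indicial_equation:
  fixes c x :: "nat \<Rightarrow> complex \<Rightarrow> complex"
  assumes diff: "\<And>j. c j field_differentiable at p" "\<And>j. x j field_differentiable at p"
    and eq: "\<And>j. \<forall>\<^sub>F z in at p. c j z + q2 z * x j z + q3 z = 0"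
    and ne: "x 0 p \<noteq> x 1 p"
  obtains A2 A3 where "(\<lambda>z. q2 z - A2) \<in> O[at p](\<lambda>z. z - p)"
    "(\<lambda>z. q3 z - A3) \<in> O[at p](\<lambda>z. z - p)" "\<And>j. c j p + A2 * x j p + A3 = 0"
proof -
  define G2 where "G2 = (\<lambda>z. (c 1 z - c 0 z) / (x 0 z - x 1 z))"
  define G3 where "G3 = (\<lambda>z. - c 0 z - G2 z * x 0 z)"
  have G2: "G2 field_differentiable at p"
    unfolding G2_def using ne by (intro field_differentiable_divide field_differentiable_diff diff) auto
  then have G3: "G3 field_differentiable at p"
    unfolding G3_def
    by (intro field_differentiable_diff field_differentiable_mult field_differentiable_minus diff)
  have cont: "(F \<longlongrightarrow> F p) (at p)" if "F field_differentiable at p" for F :: "complex \<Rightarrow> complex"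
    using field_differentiable_imp_continuous_at[OF that] by (simp add: isCont_def)
  have "((\<lambda>z. x 0 z - x 1 z) \<longlongrightarrow> x 0 p - x 1 p) (at p)" by (intro tendsto_diff cont diff)
  then have "\<forall>\<^sub>F z in at p. x 0 z - x 1 z \<noteq> 0" by (rule tendsto_imp_eventually_ne) (use ne in simp)
  then have qG: "\<forall>\<^sub>F z in at p. q2 z = G2 z \<and> q3 z = G3 z"
    using eq[of 0] eq[of 1]
  proof eventually_elim
    case (elim z)
    have "q2 z * (x 0 z - x 1 z) = c 1 z - c 0 z" using elim(2,3) by algebra
    then have "q2 z = G2 z" unfolding G2_def using elim(1) by (simp add: field_simps)
    moreover have "q3 z = - c 0 z - q2 z * x 0 z" using elim(2) by algebra
    ultimately show ?case unfolding G3_def by simp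
  qed
  show thesis
  proof
    have "(\<lambda>z. q2 z - G2 p) \<in> O[at p](\<lambda>z. z - p) \<longleftrightarrow> (\<lambda>z. G2 z - G2 p) \<in> O[at p](\<lambda>z. z - p)"
      by (rule landau_o.big.in_cong) (use qG in eventually_elim, simp)
    then show "(\<lambda>z. q2 z - G2 p) \<in> O[at p](\<lambda>z. z - p)"
      using field_differentiable_diff_bigo[OF G2] by simp
    have "(\<lambda>z. q3 z - G3 p) \<in> O[at p](\<lambda>z. z - p) \<longleftrightarrow> (\<lambda>z. G3 z - G3 p) \<in> O[at p](\<lambda>z. z - p)"
      by (rule landau_o.big.in_cong) (use qG in eventually_elim, simp)
    then show "(\<lambda>z. q3 z - G3 p) \<in> O[at p](\<lambda>z. z - p)"
      using field_differentiable_diff_bigo[OF G3] by simp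
    show "c j p + G2 p * x j p + G3 p = 0" for j
    proof -
      let ?F = "\<lambda>z. c j z + G2 z * x j z + G3 z"
      have "(?F \<longlongrightarrow> ?F p) (at p)" by (intro tendsto_intros cont diff G2 G3)
      moreover have "\<forall>\<^sub>F z in at p. ?F z = 0"
        using qG eq[of j] by eventually_elim simp
      then have "(?F \<longlongrightarrow> 0) (at p)" by (rule tendsto_eventually)
      ultimately show ?thesis by (rule tendsto_unique[OF at_neq_bot])
    qed
  qed
qed

text \<open>
  The polynomial is monic of degree 3, hence equal to the product of the linear factors at its
  three distinct roots; its quadratic coefficient is \<open>-3\<close>.
\<close>
lemma cubic_with_three_roots:
  fixes k1 k2 k3 A2 A3 :: complex
  assumes root: "\<And>k. k \<in> {k1, k2, k3} \<Longrightarrow> k * (k - 1) * (k - 2) + A2 * k + A3 = 0"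
    and distinct: "k1 \<noteq> k2" "k1 \<noteq> k3" "k2 \<noteq> k3"
  shows "proots ([:0, 1:] * [:-1, 1:] * [:-2, 1:] + [:A3, A2:]) = {#k1, k2, k3#}"
    and "k1 + k2 + k3 = 3"
proof -
  let ?P = "[:0, 1:] * [:-1, 1:] * [:-2, 1:] + [:A3, A2:]"
  let ?Q = "[:-k1, 1:] * [:-k2, 1:] * [:-k3, 1:]"
  have PQ: "?P = ?Q"
  proof (rule poly_eqI_degree_lead_coeff[where n = 3 and A = "{k1, k2, k3}"])
    show "poly ?P k = poly ?Q k" if "k \<in> {k1, k2, k3}" for k
      using root[OF that] that by (auto simp: algebra_simps)
  qed (use distinct in \<open>simp_all add: numeral_3_eq_3\<close>)
  show "proots ?P = {#k1, k2, k3#}" unfolding PQ by (simp add: proots_mult del: mult_pCons_left mult_pCons_right)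
  have "coeff ?P 2 = coeff ?Q 2" unfolding PQ ..
  then show "k1 + k2 + k3 = 3" by (simp add: numeral_2_eq_2 algebra_simps)
qed

text \<open>
  Dividing the reduced equation of \<open>uj\<close> by \<open>v\<close> gives \<open>c + q2 * x + q3 = 0\<close> near \<open>p\<close> with
  \<open>x p = \<kappa>\<close>, \<open>c p = \<kappa> (\<kappa> - 1) (\<kappa> - 2)\<close> and \<open>\<kappa> = aj - N/3\<close>.  The three relations say that these
  distinct numbers are the roots of the indicial polynomial, and the sum of its roots determines \<open>N\<close>.
\<close>
lemma local_exponents_from_orders:
  assumes ode: "normalized_ode f g h Q2 Q3"
    and hol: "f holomorphic_on upper_half_plane" "g holomorphic_on upper_half_plane"
      "h holomorphic_on upper_half_plane"
    and p: "p \<in> upper_half_plane"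
    and u: "u1 \<in> span3 f g h" "u2 \<in> span3 f g h" "u3 \<in> span3 f g h"
    and ord: "has_zero_order u1 p a1" "has_zero_order u2 p a2" "has_zero_order u3 p a3"
    and less: "a1 < a2" "a2 < a3"
    and W: "has_zero_order (wronskian3 f g h) p N"
  shows "local_exponents Q2 Q3 p (real a1 - real N / 3) (real a2 - real N / 3) (real a3 - real N / 3)"
    and "a1 + a2 + a3 = N + 3"
proof -
  \<comment> \<open>Every index above \<open>1\<close> stands for \<open>u3\<close>, so that statements about \<open>u j\<close> hold for all \<open>j\<close>.\<close>
  define u where "u = (\<lambda>j::nat. if j = 0 then u1 else if j = 1 then u2 else u3)"
  define a where "a = (\<lambda>j::nat. if j = 0 then a1 else if j = 1 then a2 else a3)"
  have us: "u j \<in> span3 f g h" and ords: "has_zero_order (u j) p (a j)" for j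
    using \<open>u1 \<in> _\<close> \<open>u2 \<in> _\<close> \<open>u3 \<in> _\<close> ord unfolding u_def a_def by auto
  obtain w Rw where w: "Rw > 0" "\<And>r. r \<le> Rw \<Longrightarrow> w holomorphic_on ball p r"
    "\<And>z. dist p z < Rw \<Longrightarrow> w z \<noteq> 0"
    "\<And>z. dist p z < Rw \<Longrightarrow> wronskian3 f g h z = (z - p) ^ N * w z"
    using has_zero_orderE[OF W] by metis
  obtain R0 where R0: "R0 > 0" "ball p R0 \<subseteq> upper_half_plane"
    using p upper_half_plane_open_connected(1) open_contains_ball by blast
  define \<sigma> where "\<sigma> = (\<lambda>z. (of_nat N + (z - p) * deriv w z / w z) / 3)"
  define \<kappa> where "\<kappa> = (\<lambda>j. of_nat (a j) - \<sigma> p)"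
  have \<sigma>p: "\<sigma> p = of_nat N / 3" unfolding \<sigma>_def by simp
  define q2 where "q2 = (\<lambda>z. (z - p) ^ 2 * Q2 z)"
  define q3 where "q3 = (\<lambda>z. (z - p) ^ 3 * Q3 z)"
  have "\<exists>c x. c field_differentiable at p \<and> x field_differentiable at p \<and>
      (\<forall>\<^sub>F z in at p. c z + q2 z * x z + q3 z = 0) \<and>
      x p = \<kappa> j \<and> c p = \<kappa> j * (\<kappa> j - 1) * (\<kappa> j - 2)" for j
  proof -
    obtain v Rv where v: "Rv > 0" "\<And>r. r \<le> Rv \<Longrightarrow> v holomorphic_on ball p r"
      "\<And>z. dist p z < Rv \<Longrightarrow> v z \<noteq> 0"
      "\<And>z. dist p z < Rv \<Longrightarrow> u j z = (z - p) ^ a j * v z"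
      using has_zero_orderE[OF ords[of j]] by metis
    define r where "r = Min {R0, Rw, Rv}"
    have r: "r > 0" "r \<le> R0" "r \<le> Rw" "r \<le> Rv" unfolding r_def using R0(1) w(1) v(1) by auto
    let ?B = "ball p r" and ?R = "reduced_deriv p \<sigma> (a j) v"
    have B: "?B \<subseteq> upper_half_plane" using R0(2) r(2) by auto
    have wB: "w holomorphic_on ?B" "\<And>z. z \<in> ?B \<Longrightarrow> w z \<noteq> 0"
        "\<And>z. z \<in> ?B \<Longrightarrow> wronskian3 f g h z = (z - p) ^ N * w z"
      using w(2)[OF r(3)] w(3,4) r(3) by auto
    have vB: "v holomorphic_on ?B" "\<And>z. z \<in> ?B \<Longrightarrow> v z \<noteq> 0"
        "\<And>z. z \<in> ?B \<Longrightarrow> u j z = (z - p) ^ a j * v z"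
      using v(2)[OF r(4)] v(3,4) r(4) by auto
    have pB: "p \<in> ?B" using r(1) by simp
    have "\<sigma> holomorphic_on ?B" unfolding \<sigma>_def by (intro holomorphic_intros wB) auto
    then have R: "(\<lambda>z. ?R m z / v z) field_differentiable at p" for m
      using reduced_deriv_holomorphic[OF vB(1) _ open_ball] vB pB
      by (intro holomorphic_on_imp_differentiable_at[OF _ open_ball pB] holomorphic_on_divide) auto
    have "\<forall>\<^sub>F z in at p. z \<in> ?B - {p}" using pB by (intro eventually_at_in_open) auto
    then have "\<forall>\<^sub>F z in at p. ?R 3 z / v z + q2 z * (?R 1 z / v z) + q3 z = 0"
    proof eventually_elim
      case (elim z)
      have "?R 3 z + (z - p) ^ 2 * Q2 z * ?R 1 z + (z - p) ^ 3 * Q3 z * v z = 0"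
        by (rule reduced_ode[OF ode hol B wB \<sigma>_def us[of j] vB(1,3) elim])
      then have "(?R 3 z + q2 z * ?R 1 z + q3 z * v z) / v z = 0" unfolding q2_def q3_def by simp
      then show ?case using vB(2) elim by (simp add: add_divide_distrib del: reduced_deriv.simps)
    qed
    moreover have "?R 1 p / v p = \<kappa> j" "?R 3 p / v p = \<kappa> j * (\<kappa> j - 1) * (\<kappa> j - 2)"
    proof -
      have \<kappa>j: "of_nat (a j) - \<sigma> p = \<kappa> j" unfolding \<kappa>_def ..
      show "?R 1 p / v p = \<kappa> j" "?R 3 p / v p = \<kappa> j * (\<kappa> j - 1) * (\<kappa> j - 2)"
        using vB(2)[OF pB] unfolding reduced_deriv_center \<kappa>j by (simp_all add: numeral_3_eq_3)
    qed
    ultimately show ?thesis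
      using R[of 1] R[of 3]
      by (intro exI[of _ "\<lambda>z. ?R 3 z / v z"] exI[of _ "\<lambda>z. ?R 1 z / v z"] conjI)
  qed
  then have "\<forall>j. \<exists>c x. c field_differentiable at p \<and> x field_differentiable at p \<and>
      (\<forall>\<^sub>F z in at p. c z + q2 z * x z + q3 z = 0) \<and>
      x p = \<kappa> j \<and> c p = \<kappa> j * (\<kappa> j - 1) * (\<kappa> j - 2)" by blast
  then have "\<exists>c x. \<forall>j. c j field_differentiable at p \<and> x j field_differentiable at p \<and>
      (\<forall>\<^sub>F z in at p. c j z + q2 z * x j z + q3 z = 0) \<and>
      x j p = \<kappa> j \<and> c j p = \<kappa> j * (\<kappa> j - 1) * (\<kappa> j - 2)"
    unfolding choice_iff .
  then obtain c x where cx: "\<And>j. c j field_differentiable at p" "\<And>j. x j field_differentiable at p"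
      "\<And>j. \<forall>\<^sub>F z in at p. c j z + q2 z * x j z + q3 z = 0"
      "\<And>j. x j p = \<kappa> j" "\<And>j. c j p = \<kappa> j * (\<kappa> j - 1) * (\<kappa> j - 2)"
    by blast
  have ne: "\<kappa> 0 \<noteq> \<kappa> 1" "\<kappa> 0 \<noteq> \<kappa> 2" "\<kappa> 1 \<noteq> \<kappa> 2" using less unfolding \<kappa>_def a_def by auto
  then have "x 0 p \<noteq> x 1 p" using cx(4) by simp
  then obtain A2 A3 where A: "(\<lambda>z. q2 z - A2) \<in> O[at p](\<lambda>z. z - p)"
    "(\<lambda>z. q3 z - A3) \<in> O[at p](\<lambda>z. z - p)" "\<And>j. c j p + A2 * x j p + A3 = 0"
    by (rule indicial_equation[of c p x q2 q3, OF cx(1,2,3)]) blast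
  have "k * (k - 1) * (k - 2) + A2 * k + A3 = 0" if "k \<in> {\<kappa> 0, \<kappa> 1, \<kappa> 2}" for k
    using that A(3)[of 0] A(3)[of 1] A(3)[of 2] cx(4,5) by auto
  note roots = cubic_with_three_roots[OF this ne]
  have \<kappa>: "\<kappa> 0 = of_real (real a1 - real N / 3)" "\<kappa> 1 = of_real (real a2 - real N / 3)"
      "\<kappa> 2 = of_real (real a3 - real N / 3)"
    unfolding \<kappa>_def \<sigma>p a_def by simp_all
  have punctured: "\<forall>\<^sub>F z in at p. z - p \<noteq> 0" by (simp add: eventually_at_filter)
  have "(\<lambda>z. (q2 z - A2) / (z - p) ^ 2) \<in> O[at p](\<lambda>z. (z - p) / (z - p) ^ 2)"
    by (intro landau_o.big.divide_right A(1) eventually_mono[OF punctured]) simp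
  also have "?this \<longleftrightarrow> (\<lambda>z. Q2 z - A2 / (z - p) ^ 2) \<in> O[at p](\<lambda>z. 1 / (z - p))"
    by (intro landau_o.big.cong_ex eventually_mono[OF punctured])
      (simp add: q2_def diff_divide_distrib, simp add: power2_eq_square)
  finally have O2: "(\<lambda>z. Q2 z - A2 / (z - p) ^ 2) \<in> O[at p](\<lambda>z. 1 / (z - p))" .
  have "(\<lambda>z. (q3 z - A3) / (z - p) ^ 3) \<in> O[at p](\<lambda>z. (z - p) / (z - p) ^ 3)"
    by (intro landau_o.big.divide_right A(2) eventually_mono[OF punctured]) simp
  also have "?this \<longleftrightarrow> (\<lambda>z. Q3 z - A3 / (z - p) ^ 3) \<in> O[at p](\<lambda>z. 1 / (z - p) ^ 2)"
    by (intro landau_o.big.cong_ex eventually_mono[OF punctured])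
      (simp add: q3_def diff_divide_distrib, simp add: power2_eq_square power3_eq_cube)
  finally have O3: "(\<lambda>z. Q3 z - A3 / (z - p) ^ 3) \<in> O[at p](\<lambda>z. 1 / (z - p) ^ 2)" .
  show "local_exponents Q2 Q3 p (real a1 - real N / 3) (real a2 - real N / 3) (real a3 - real N / 3)"
    unfolding local_exponents_def using less O2 O3 roots(1)[unfolded \<kappa>] by auto
  have "of_real ((real a1 - real N / 3) + (real a2 - real N / 3) + (real a3 - real N / 3)) =
      (of_real 3 :: complex)"
    using roots(2) unfolding \<kappa> by simp
  then have "real a1 + real a2 + real a3 - real N = 3"
    unfolding of_real_eq_iff by simp
  then show "a1 + a2 + a3 = N + 3" by linarith
qed

text \<open>
  The Wronskian of \<open>u1\<close>, \<open>u2\<close>, \<open>u3\<close> is nonzero on a punctured neighbourhood of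
  \<open>p\<close>, hence that of \<open>f\<close>, \<open>g\<close>, \<open>h\<close> is not identically zero and has a finite vanishing order \<open>N\<close>.
\<close>
lemma exponents_at_point:
  assumes ode: "normalized_ode f g h Q2 Q3"
    and hol: "f holomorphic_on upper_half_plane" "g holomorphic_on upper_half_plane"
      "h holomorphic_on upper_half_plane"
    and indep: "lin_indep3 f g h" and p: "p \<in> upper_half_plane"
  obtains u1 u2 u3 a1 a2 a3 N where "u1 \<in> span3 f g h" "u2 \<in> span3 f g h" "u3 \<in> span3 f g h"
    "has_zero_order u1 p a1" "has_zero_order u2 p a2" "has_zero_order u3 p a3"
    "a1 + a2 + a3 = N + 3"
    "local_exponents Q2 Q3 p (real a1 - real N / 3) (real a2 - real N / 3) (real a3 - real N / 3)"
proof -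
  obtain u1 u2 u3 a1 a2 a3 where u: "u1 \<in> span3 f g h" "u2 \<in> span3 f g h" "u3 \<in> span3 f g h"
    and ord: "has_zero_order u1 p a1" "has_zero_order u2 p a2" "has_zero_order u3 p a3"
    and less: "a1 < a2" "a2 < a3"
    by (rule span3_three_orders[OF hol indep p])
  note H = upper_half_plane_open_connected
  have "\<forall>\<^sub>F z in at p. wronskian3 u1 u2 u3 z \<noteq> 0"
    using less by (intro wronskian3_nonzero_of_distinct_orders[OF ord]) auto
  moreover have "\<forall>\<^sub>F z in at p. z \<in> upper_half_plane - {p}"
    using p H(1) by (intro eventually_at_in_open)
  ultimately have "\<forall>\<^sub>F z in at p. wronskian3 u1 u2 u3 z \<noteq> 0 \<and> z \<in> upper_half_plane"
    by eventually_elim simp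
  then obtain z where "wronskian3 u1 u2 u3 z \<noteq> 0" "z \<in> upper_half_plane"
    using eventually_happens'[OF at_neq_bot] by blast
  then obtain N where "has_zero_order (wronskian3 f g h) p N"
    using holomorphic_has_zero_order[OF wronskian3_holomorphic[OF hol H(1)] H p]
      wronskian3_span3[OF hol H(1) _ u] by blast
  from local_exponents_from_orders[OF ode hol p u ord less this] that u ord show thesis by blast
qed

section \<open>Vanishing orders at the fixed points of modular transformations\<close>

text \<open>
  Write \<open>u z = (z - p)^n * v z\<close> with \<open>v p \<noteq> 0\<close>.  Since \<open>\<gamma> z - p = m z * (z - p)\<close>, the
  transformation law becomes \<open>m z ^ n * v (\<gamma> z) = j z * v z\<close> off \<open>p\<close>; the claim is its limit
  at \<open>p\<close>, where \<open>v p\<close> cancels.  Here \<open>\<mu>\<close> is the derivative of \<open>\<gamma>\<close> at its fixed point.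
\<close>
lemma zero_order_multiplier:
  assumes ord: "has_zero_order u p n"
    and trans: "\<forall>\<^sub>F z in at p. u (\<gamma> z) = j z * u z"
    and fix_p: "\<gamma> \<midarrow>p\<rightarrow> p" "\<forall>\<^sub>F z in at p. \<gamma> z - p = m z * (z - p)"
    and lim: "m \<midarrow>p\<rightarrow> \<mu>" "j \<midarrow>p\<rightarrow> \<nu>"
  shows "\<mu> ^ n = \<nu>"
proof -
  obtain v R where v: "R > 0" "v holomorphic_on ball p R"
    "\<And>z. dist p z < R \<Longrightarrow> v z \<noteq> 0" "\<And>z. dist p z < R \<Longrightarrow> u z = (z - p) ^ n * v z"
    using has_zero_orderE[OF ord] by (metis order_refl)
  have "isCont v p"
    using v(1) holomorphic_on_imp_continuous_on[OF v(2)] by (simp add: continuous_on_eq_continuous_at)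
  then have v_lim: "v \<midarrow>p\<rightarrow> v p" "(\<lambda>z. v (\<gamma> z)) \<midarrow>p\<rightarrow> v p"
    using isCont_tendsto_compose[OF _ fix_p(1)] by (auto simp: isCont_def)
  have "\<forall>\<^sub>F z in at p. dist (\<gamma> z) p < R" using fix_p(1) v(1) by (rule tendstoD)
  moreover have "\<forall>\<^sub>F z in at p. z \<in> ball p R - {p}" using v(1) by (intro eventually_at_in_open) auto
  ultimately have "\<forall>\<^sub>F z in at p. m z ^ n * v (\<gamma> z) = j z * v z"
    using trans fix_p(2)
  proof eventually_elim
    case (elim z)
    have "(z - p) ^ n * (m z ^ n * v (\<gamma> z)) = (\<gamma> z - p) ^ n * v (\<gamma> z)"
      unfolding elim(4) by (simp add: power_mult_distrib mult_ac)
    also have "\<dots> = u (\<gamma> z)" using v(4)[of "\<gamma> z"] elim(1) by (simp add: dist_commute)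
    also have "\<dots> = j z * ((z - p) ^ n * v z)" using elim(2,3) v(4)[of z] by simp
    finally have "(z - p) ^ n * (m z ^ n * v (\<gamma> z)) = (z - p) ^ n * (j z * v z)" by simp
    then show ?case using elim(2) by simp
  qed
  moreover have "(\<lambda>z. m z ^ n * v (\<gamma> z)) \<midarrow>p\<rightarrow> \<mu> ^ n * v p"
    and "(\<lambda>z. j z * v z) \<midarrow>p\<rightarrow> \<nu> * v p"
    by (intro tendsto_intros lim v_lim)+
  ultimately have "(\<lambda>z. j z * v z) \<midarrow>p\<rightarrow> \<mu> ^ n * v p"
    using tendsto_cong by fast
  then have "\<mu> ^ n * v p = \<nu> * v p"
    using \<open>(\<lambda>z. j z * v z) \<midarrow>p\<rightarrow> \<nu> * v p\<close> by (rule tendsto_unique[OF at_neq_bot])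
  then show ?thesis using v(1,3) by simp
qed

lemma modular_form_transform:
  fixes a b c d :: int
  assumes "modular_form k u" "a * d - b * c = 1" "z \<in> upper_half_plane"
  shows "u ((of_int a * z + of_int b) / (of_int c * z + of_int d)) =
    (of_int c * z + of_int d) powi k * u z"
  using assms unfolding modular_form_def by blast

lemma span3_transform:
  fixes a b c d :: int
  assumes mod: "modular_form k f" "modular_form k g" "modular_form k h"
    and u: "u \<in> span3 f g h" and abcd: "a * d - b * c = 1" and z: "z \<in> upper_half_plane"
  shows "u ((of_int a * z + of_int b) / (of_int c * z + of_int d)) =
    (of_int c * z + of_int d) powi k * u z"
proof -
  obtain x y t where u_eq: "u = (\<lambda>z. x * f z + y * g z + t * h z)"
    using u unfolding span3_def by blast
  show ?thesis
    unfolding u_eq mod[THEN modular_form_transform, OF abcd z] by (simp add: algebra_simps)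
qed

text \<open>
  For \<open>\<gamma> z = (a z + b) / (c z + d)\<close> with \<open>\<gamma> p = p\<close> one has
  \<open>\<gamma> z - p = (z - p) / ((c z + d) (c p + d))\<close>.
\<close>
lemma zero_order_at_fixed_point:
  fixes a b c d :: int
  assumes mod: "modular_form k f" "modular_form k g" "modular_form k h"
    and u: "u \<in> span3 f g h" and abcd: "a * d - b * c = 1"
    and p: "p \<in> upper_half_plane" "of_int c * p + of_int d \<noteq> 0"
    and fixed: "of_int a * p + of_int b = p * (of_int c * p + of_int d)"
    and ord: "has_zero_order u p n"
  shows "(1 / (of_int c * p + of_int d) ^ 2) ^ n = (of_int c * p + of_int d) powi k"
proof (rule zero_order_multiplier[OF ord])
  let ?j = "\<lambda>z. of_int c * z + of_int d :: complex"
  let ?\<gamma> = "\<lambda>z. (of_int a * z + of_int b) / ?j z"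
  let ?m = "\<lambda>z. 1 / (?j z * ?j p)"
  have abcd': "of_int a * of_int d - of_int b * of_int c = (1::complex)"
    using arg_cong[OF abcd, of of_int] by simp
  have j: "?j \<midarrow>p\<rightarrow> ?j p" by (intro tendsto_intros)
  then have j_ne: "\<forall>\<^sub>F z in at p. ?j z \<noteq> 0" using p(2) by (rule tendsto_imp_eventually_ne)
  have "\<forall>\<^sub>F z in at p. z \<in> upper_half_plane - {p}"
    using p(1) upper_half_plane_open_connected(1) by (intro eventually_at_in_open)
  then show "\<forall>\<^sub>F z in at p. u (?\<gamma> z) = ?j z powi k * u z"
    by eventually_elim (use span3_transform[OF mod u abcd] in simp)
  have "?\<gamma> \<midarrow>p\<rightarrow> (of_int a * p + of_int b) / ?j p" by (intro tendsto_intros p(2))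
  then show "?\<gamma> \<midarrow>p\<rightarrow> p" using fixed p(2) by simp
  show "\<forall>\<^sub>F z in at p. ?\<gamma> z - p = ?m z * (z - p)"
    using j_ne
  proof eventually_elim
    case (elim z)
    have "(of_int a * z + of_int b) * ?j p - p * ?j p * ?j z = z - p"
      unfolding fixed[symmetric] using abcd' by algebra
    then show ?case using elim p(2) by (simp add: divide_simps) (simp add: algebra_simps)
  qed
  have "?m \<midarrow>p\<rightarrow> 1 / (?j p * ?j p)" by (intro tendsto_intros) (use p(2) in simp)
  then show "?m \<midarrow>p\<rightarrow> 1 / ?j p ^ 2" by (simp add: power2_eq_square)
  show "(\<lambda>z. ?j z powi k) \<midarrow>p\<rightarrow> ?j p powi k" by (intro tendsto_power_int j p(2))
qed

section \<open>The elliptic points\<close>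

lemma primitive_cube_root_power_eq:
  fixes \<omega> :: complex
  assumes \<omega>: "\<omega> ^ 2 + \<omega> + 1 = 0" and eq: "\<omega> ^ m = \<omega> ^ n"
  shows "m mod 3 = n mod 3"
proof -
  have 3: "\<omega> ^ 3 = 1" using \<omega> by algebra
  have ne: "\<omega> \<noteq> 1" "\<omega> ^ 2 \<noteq> 1" "\<omega> ^ 2 \<noteq> \<omega>"
  proof -
    show "\<omega> \<noteq> 1" using \<omega> by auto
    then show "\<omega> ^ 2 \<noteq> 1" "\<omega> ^ 2 \<noteq> \<omega>" using \<omega> 3 by algebra+
  qed
  have red: "\<omega> ^ l = \<omega> ^ (l mod 3)" for l
    using 3 by (metis mult_div_mod_eq power_add power_mult power_one mult_1)
  have eq': "\<omega> ^ (m mod 3) = \<omega> ^ (n mod 3)" using eq red by metis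
  have "l mod 3 = 0 \<or> l mod 3 = 1 \<or> l mod 3 = 2" for l :: nat by linarith
  from this[of m] this[of n] show ?thesis
    using eq' ne by (elim disjE) simp_all
qed

theorem proposition4p3:
  fixes k :: int and f g h Q2 Q3 :: "complex \<Rightarrow> complex" and \<rho> :: complex
  assumes "modular_form k f" and "modular_form k g" and "modular_form k h"
    and "lin_indep3 f g h"
    and "normalized_ode f g h Q2 Q3"
    and "\<rho> = (-1 + of_real (sqrt 3) * \<i>) / 2"
  shows "(\<exists>\<kappa>1 \<kappa>2 \<kappa>3. local_exponents Q2 Q3 \<i> \<kappa>1 \<kappa>2 \<kappa>3 \<and>
            [\<kappa>2 - \<kappa>1 = \<kappa>3 - \<kappa>1] (rmod 2) \<and> [\<kappa>3 - \<kappa>1 = 0] (rmod 2)) \<and>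
         (\<exists>\<kappa>1 \<kappa>2 \<kappa>3. local_exponents Q2 Q3 \<rho> \<kappa>1 \<kappa>2 \<kappa>3 \<and>
            \<kappa>1 \<in> \<int> \<and> \<kappa>2 \<in> \<int> \<and> \<kappa>3 \<in> \<int> \<and>
            [\<kappa>1 = \<kappa>2] (rmod 3) \<and> [\<kappa>2 = \<kappa>3] (rmod 3))"
proof
  have hol: "f holomorphic_on upper_half_plane" "g holomorphic_on upper_half_plane"
      "h holomorphic_on upper_half_plane"
    using assms(1-3) unfolding modular_form_def by auto
  note mod = assms(1-3)
  show "\<exists>\<kappa>1 \<kappa>2 \<kappa>3. local_exponents Q2 Q3 \<i> \<kappa>1 \<kappa>2 \<kappa>3 \<and>
            [\<kappa>2 - \<kappa>1 = \<kappa>3 - \<kappa>1] (rmod 2) \<and> [\<kappa>3 - \<kappa>1 = 0] (rmod 2)"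
  proof -
    have H: "\<i> \<in> upper_half_plane" unfolding upper_half_plane_def by simp
    obtain u1 u2 u3 a1 a2 a3 N where u: "u1 \<in> span3 f g h" "u2 \<in> span3 f g h" "u3 \<in> span3 f g h"
      and ord: "has_zero_order u1 \<i> a1" "has_zero_order u2 \<i> a2" "has_zero_order u3 \<i> a3"
      and exps: "local_exponents Q2 Q3 \<i> (real a1 - real N / 3) (real a2 - real N / 3) (real a3 - real N / 3)"
      using exponents_at_point[OF assms(5) hol assms(4) H] by metis
    have "(-1) ^ n = \<i> powi k" if "v \<in> span3 f g h" "has_zero_order v \<i> n" for v n
      using zero_order_at_fixed_point[OF mod that(1), of 0 0 "-1" 1 \<i> n] H that(2) by simp
    from this[OF u(1) ord(1)] this[OF u(2) ord(2)] this[OF u(3) ord(3)]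
    have "(-1 :: complex) ^ a1 = (-1) ^ a2" "(-1 :: complex) ^ a1 = (-1) ^ a3" by simp_all
    then have "even (int a3 - int a2)" "even (int a1 - int a3)"
      by (auto simp: minus_one_power_iff split: if_splits)
    then obtain s t where st: "int a3 - int a2 = 2 * s" "int a1 - int a3 = 2 * t" by (elim evenE)
    have "real a3 = real a2 + of_int s * 2" "real a1 = real a3 + of_int t * 2"
      using arg_cong[OF st(1), of real_of_int] arg_cong[OF st(2), of real_of_int] by simp_all
    with exps show ?thesis
      by (intro exI[of _ "real a1 - real N / 3"] exI[of _ "real a2 - real N / 3"]
          exI[of _ "real a3 - real N / 3"]) (auto simp: rcong_altdef)
  qed
  show "\<exists>\<kappa>1 \<kappa>2 \<kappa>3. local_exponents Q2 Q3 \<rho> \<kappa>1 \<kappa>2 \<kappa>3 \<and>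
            \<kappa>1 \<in> \<int> \<and> \<kappa>2 \<in> \<int> \<and> \<kappa>3 \<in> \<int> \<and>
            [\<kappa>1 = \<kappa>2] (rmod 3) \<and> [\<kappa>2 = \<kappa>3] (rmod 3)"
  proof -
    have H: "\<rho> \<in> upper_half_plane" unfolding upper_half_plane_def assms(6) by simp
    have \<rho>: "\<rho> ^ 2 + \<rho> + 1 = 0"
      unfolding assms(6) by (simp add: complex_eq_iff power2_eq_square)
    then have "\<rho> * (\<rho> + 1) = -1" by algebra
    then have \<rho>0: "\<rho> + 1 \<noteq> 0" by auto
    have \<rho>2: "1 / (\<rho> + 1) ^ 2 = \<rho> ^ 2"
    proof -
      have "\<rho> ^ 2 * (\<rho> + 1) ^ 2 = 1" using \<rho> by algebra
      then show ?thesis using \<rho>0 by (simp add: field_simps)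
    qed
    have \<rho>2_root: "(\<rho> ^ 2) ^ 2 + \<rho> ^ 2 + 1 = 0" using \<rho> by algebra
    obtain u1 u2 u3 a1 a2 a3 N where u: "u1 \<in> span3 f g h" "u2 \<in> span3 f g h" "u3 \<in> span3 f g h"
      and ord: "has_zero_order u1 \<rho> a1" "has_zero_order u2 \<rho> a2" "has_zero_order u3 \<rho> a3"
      and sum: "a1 + a2 + a3 = N + 3"
      and exps: "local_exponents Q2 Q3 \<rho> (real a1 - real N / 3) (real a2 - real N / 3) (real a3 - real N / 3)"
      using exponents_at_point[OF assms(5) hol assms(4) H] by metis
    have "\<rho> * \<rho> + \<rho> = -1" using \<rho> by algebra
    then have "(\<rho> ^ 2) ^ n = (\<rho> + 1) powi k" if "v \<in> span3 f g h" "has_zero_order v \<rho> n" for v n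
      using zero_order_at_fixed_point[OF mod that(1), of 0 1 "-1" 1 \<rho> n] H that(2) \<rho>0 \<rho>2
      by (simp add: distrib_left)
    from this[OF u(1) ord(1)] this[OF u(2) ord(2)] this[OF u(3) ord(3)]
    have "(\<rho> ^ 2) ^ a1 = (\<rho> ^ 2) ^ a2" "(\<rho> ^ 2) ^ a2 = (\<rho> ^ 2) ^ a3" by simp_all
    then have cong: "a1 mod 3 = a2 mod 3" "a2 mod 3 = a3 mod 3"
      using primitive_cube_root_power_eq[OF \<rho>2_root] by blast+
    have "3 dvd int a2 - int a1" "3 dvd int a3 - int a2"
      using arg_cong[OF cong(1), of int] arg_cong[OF cong(2), of int]
      by (simp_all add: zmod_int mod_eq_dvd_iff dvd_diff_commute)
    then obtain s t where st: "int a2 - int a1 = 3 * s" "int a3 - int a2 = 3 * t"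
      by (elim dvdE) blast
    have a: "real a2 = real a1 + of_int s * 3" "real a3 = real a2 + of_int t * 3"
      using arg_cong[OF st(1), of real_of_int] arg_cong[OF st(2), of real_of_int] by simp_all
    have "real a1 + real a2 + real a3 = real N + 3"
      using arg_cong[OF sum, of real] by simp
    then have "real N / 3 = of_int (int a1 + 2 * s + t - 1)" using a by simp
    then have "real N / 3 \<in> \<int>" by (metis Ints_of_int)
    then have ints: "real n - real N / 3 \<in> \<int>" for n by (intro Ints_diff) auto
    show ?thesis using exps ints a
      by (intro exI[of _ "real a1 - real N / 3"] exI[of _ "real a2 - real N / 3"]
          exI[of _ "real a3 - real N / 3"]) (auto simp: rcong_altdef)
  qed
qed

end
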